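(* Let $X$, $d$, $\mu$, $\mathcal{S}$ and the subdivision algorithm be as described in the context, with constants $0<\varepsilon_1,\varepsilon_2<1$ such that every subdivision of a region $J$ into $J_1,\dots,J_k$ performed by the algorithm satisfies $\mu(J_j)\ge\varepsilon_1\mu(J)$ and $\operatorname{Diam}(J_j)\le\varepsilon_2\operatorname{Diam}(J)$ for all $j$. Suppose that the stopping criteria $C_1,\dots,C_\ell$ used by the algorithm are all diameter-distance tests, with associated positive constants $K_i$ and closed subsets $V_i\subseteq X$. Assume that $\bigcap_{i=1}^\ell V_i=\emptyset$. Let $I\in\mathcal{S}$ with $\mu(I)>0$ be the initial input region. Then the number of regions in the final partition constructed by the algorithm is at most $$\max\left\{1,\ \mu(I)^{-1}\int_I\min_{1\le i\le \ell}\left\{\varepsilon_1^{-1+\frac{\ln(\operatorname{Diam}(I))-\ln(K_i d(x,V_i))}{\ln(\varepsilon_2)}}\right\}d\mu(x)\right\}.$$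
   Context: Setting: $X$ is a measure space with measure $\mu$ and also a metric space with distance $d$ (no compatibility between $\mu$ and $d$ is required); $X$ is proper, i.e. closed balls are compact. $\mathcal{S}$ is a collection of subsets of $X$ that have finite $\mu$-measure and are compact. A stopping criterion is a function $C:\mathcal{S}\to\{\text{True},\text{False}\}$. $\operatorname{Diam}$ denotes the diameter with respect to $d$. Diameter-distance test: a stopping criterion $C$ is a diameter-distance test with constant $K>0$ and closed set $V\subseteq X$ if for every $J\in\mathcal{S}$: whenever $\operatorname{Diam}(J)<K\max_{x\in J}d(x,V)$, then $C(J)=\text{True}$; here $d(x,V)=\min_{v\in V}d(x,v)$. Algorithm: fix stopping criteria $C_1,\dots,C_\ell$ and an input region $I\in\mathcal{S}$. Start with $P=\{I\}$. As long as some $J\in P$ has $C_i(J)=\text{False}$ for all $i$, subdivide $J$, i.e. replace $J$ in $P$ by regions $J_1,\dots,J_k\in\mathcal{S}$ ($k\ge2$) with $J=\bigcup_j J_j$ and with pairwise intersections of $\mu$-measure zero. Regions $J$ with $C_i(J)=\text{True}$ for some $i$ are not subdivided. The regions constructed by the algorithm are the (terminal) elements of the final $P$. Convention: an expression in the minimum with $d(x,V_i)=0$ has the value $+\infty$ (since $\ln\varepsilon_2<0$ and $0<\varepsilon_1<1$). *)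

theory Defs
  imports "HOL-Analysis.Analysis" "HOL-Library.Multiset"
begin

text \<open>The distance $d(x,V)$; the library's \<^const>\<open>infdist\<close> is \<open>0\<close> for empty \<open>V\<close>, whereas
  the minimum over the empty set is $+\infty$ here.\<close>

definition set_distance :: "'a::metric_space \<Rightarrow> 'a set \<Rightarrow> ereal" where
  "set_distance x V = (if V = {} then \<infinity> else ereal (infdist x V))"

text \<open>For a nonempty compact region the supremum below is a maximum. The condition is void for
  \<open>J = {}\<close>, where the supremum is $-\infty$.\<close>

definition diameter_distance_test ::
    "'a::metric_space set set \<Rightarrow> ('a set \<Rightarrow> bool) \<Rightarrow> real \<Rightarrow> 'a set \<Rightarrow> bool" where
  "diameter_distance_test S C K V \<longleftrightarrow>
     0 < K \<and> closed V \<and>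
     (\<forall>J\<in>S. ereal (diameter J) < ereal K * (SUP x\<in>J. set_distance x V) \<longrightarrow> C J)"

definition subdivision :: "'a measure \<Rightarrow> 'a set set \<Rightarrow> 'a set \<Rightarrow> 'a set list \<Rightarrow> bool" where
  "subdivision M S J Js \<longleftrightarrow>
     2 \<le> length Js \<and> set Js \<subseteq> S \<and> J = \<Union> (set Js) \<and>
     (\<forall>i<length Js. \<forall>j<length Js. i \<noteq> j \<longrightarrow> emeasure M (Js ! i \<inter> Js ! j) = 0)"

text \<open>\<open>subdivision_run M S C l I T P\<close>: starting from the partition \<open>{I}\<close> the algorithm with
  criteria \<open>C 1, \<dots>, C l\<close> can arrive at \<open>P\<close>, where \<open>T\<close> lists the subdivisions
  \<open>(J, [J\<^sub>1, \<dots>, J\<^sub>k])\<close> performed on the way. Partitions are multisets so that the regions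
  \<open>J\<^sub>1, \<dots>, J\<^sub>k\<close> are counted as a family.\<close>

inductive subdivision_run ::
    "'a measure \<Rightarrow> 'a set set \<Rightarrow> (nat \<Rightarrow> 'a set \<Rightarrow> bool) \<Rightarrow> nat \<Rightarrow> 'a set \<Rightarrow>
     ('a set \<times> 'a set list) list \<Rightarrow> 'a set multiset \<Rightarrow> bool"
  for M S C l I where
  start: "subdivision_run M S C l I [] {#I#}"
| subdivide: "subdivision_run M S C l I ((J, Js) # T) (P - {#J#} + mset Js)"
    if "subdivision_run M S C l I T P" "J \<in># P" "\<forall>i\<in>{1..l}. \<not> C i J" "subdivision M S J Js"

definition final_partition :: "(nat \<Rightarrow> 'a set \<Rightarrow> bool) \<Rightarrow> nat \<Rightarrow> 'a set multiset \<Rightarrow> bool" where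
  "final_partition C l P \<longleftrightarrow> (\<forall>J\<in>#P. \<exists>i\<in>{1..l}. C i J)"

text \<open>The value of
  $\varepsilon_1^{-1 + (\ln D - \ln (K\, d(x,V))) / \ln \varepsilon_2}$ in $[0,\infty]$, read with
  $\ln 0 = -\infty$ and $\ln \infty = \infty$. Since $\ln \varepsilon_2 < 0$ and
  $0 < \varepsilon_1 < 1$, it is $\infty$ for $d(x,V) = 0$, and otherwise $0$ if
  $d(x,V) = \infty$ or $D = 0$.\<close>

definition bound_term ::
    "real \<Rightarrow> real \<Rightarrow> real \<Rightarrow> real \<Rightarrow> 'a::metric_space set \<Rightarrow> 'a \<Rightarrow> ennreal" where
  "bound_term \<epsilon>\<^sub>1 \<epsilon>\<^sub>2 D K V x =
     (if set_distance x V = 0 then \<infinity>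
      else if set_distance x V = \<infinity> \<or> D = 0 then 0
      else ennreal (\<epsilon>\<^sub>1 powr (- 1 + (ln D - ln (K * infdist x V)) / ln \<epsilon>\<^sub>2)))"

end

theory Submission
  imports Defs
begin

text \<open>
  A terminal region \<open>J\<close> of depth \<open>n + 1\<close> has a parent \<open>J'\<close> that failed every test, so
  \<open>K\<^sub>i d(x, V\<^sub>i) \<le> Diam J' \<le> \<epsilon>\<^sub>2\<^sup>n Diam I\<close> for all \<open>x \<in> J\<close>. This makes the integrand at least
  \<open>\<epsilon>\<^sub>1\<^sup>-\<^sup>(\<^sup>n\<^sup>+\<^sup>1\<^sup>)\<close> on \<open>J\<close>, whereas \<open>\<mu>(J) \<ge> \<epsilon>\<^sub>1\<^sup>n\<^sup>+\<^sup>1 \<mu>(I)\<close>. Hence every terminal region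
  contributes at least \<open>\<mu>(I)\<close> to the integral. The integrand need not be measurable, as \<open>\<mu>\<close> and
  \<open>d\<close> are unrelated; the integral is then a lower integral, which is bounded from below by that of
  a simple function that is constant on each terminal region.
\<close>

text \<open>A failed test bounds \<open>K * d(x, V)\<close> by the diameter at every point of
  \<open>J\<close>. Taking logarithms and dividing by the negative
  \<open>ln \<epsilon>\<^sub>2\<close> bounds the quotient in the exponent by \<open>-n\<close>. The
  summand \<open>-1\<close> of the exponent supplies one more level, matching the children of
  \<open>J\<close> when \<open>J\<close> has depth \<open>n\<close>.\<close>

lemma bound_term_ge:
  assumes test: "diameter_distance_test S C K V" and "J \<in> S" "\<not> C J" "bounded J" "x \<in> J"
    and diam: "diameter J \<le> \<epsilon>\<^sub>2 ^ n * D"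
    and eps: "0 < \<epsilon>\<^sub>1" "\<epsilon>\<^sub>1 < 1" "0 < \<epsilon>\<^sub>2" "\<epsilon>\<^sub>2 < 1"
  shows "ennreal (1 / \<epsilon>\<^sub>1 ^ Suc n) \<le> bound_term \<epsilon>\<^sub>1 \<epsilon>\<^sub>2 D K V x"
proof (cases "set_distance x V = 0")
  case True
  then show ?thesis by (simp add: bound_term_def)
next
  case False
  have K: "0 < K" using test by (simp add: diameter_distance_test_def)
  have "ereal K * (SUP x\<in>J. set_distance x V) \<le> ereal (diameter J)"
    using test \<open>J \<in> S\<close> \<open>\<not> C J\<close> unfolding diameter_distance_test_def by (meson not_less)
  moreover have "ereal K * set_distance x V \<le> ereal K * (SUP x\<in>J. set_distance x V)"
    using \<open>x \<in> J\<close> K by (intro ereal_mult_left_mono SUP_upper) auto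
  ultimately have le: "ereal K * set_distance x V \<le> ereal (diameter J)"
    by (rule order_trans[rotated])
  \<comment> \<open>For empty \<open>V\<close> the left side of \<open>le\<close> would be infinite,
    but a diameter is a real number.\<close>
  have V: "V \<noteq> {}"
    using le K by (auto simp: set_distance_def)
  define d where "d = infdist x V"
  have d: "0 < d"
    using False V infdist_nonneg[of x V] by (auto simp: set_distance_def d_def zero_ereal_def)
  have Kd: "K * d \<le> \<epsilon>\<^sub>2 ^ n * D"
    using le V diam by (simp add: set_distance_def d_def)
  \<comment> \<open>This rules out \<open>D = 0\<close>, where \<open>bound_term\<close> is 0, and
    makes \<open>ln D\<close> a genuine logarithm.\<close>
  have "0 < \<epsilon>\<^sub>2 ^ n * D"
    using Kd K d by (meson less_le_trans mult_pos_pos)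
  then have D: "0 < D"
    using eps by (simp add: zero_less_mult_iff)
  have "ln (K * d) \<le> ln (\<epsilon>\<^sub>2 ^ n * D)"
    using Kd K d D eps by simp
  also have "\<dots> = n * ln \<epsilon>\<^sub>2 + ln D"
    using D eps by (simp add: ln_mult ln_realpow)
  finally have "- real n * ln \<epsilon>\<^sub>2 \<le> ln D - ln (K * d)" by simp
  moreover have "ln \<epsilon>\<^sub>2 < 0" using eps by simp
  ultimately have "(ln D - ln (K * d)) / ln \<epsilon>\<^sub>2 \<le> - real n"
    by (simp add: neg_divide_le_eq)
  then have "\<epsilon>\<^sub>1 powr (- real (Suc n)) \<le> \<epsilon>\<^sub>1 powr (- 1 + (ln D - ln (K * d)) / ln \<epsilon>\<^sub>2)"
    using eps by (intro powr_mono') auto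
  moreover have "\<epsilon>\<^sub>1 powr (- real (Suc n)) = 1 / \<epsilon>\<^sub>1 ^ Suc n"
    using eps by (simp only: powr_minus powr_realpow inverse_eq_divide)
  ultimately show ?thesis
    using V D d by (simp add: bound_term_def set_distance_def d_def zero_ereal_def ennreal_leI)
qed

text \<open>There are finitely many pairs of pieces, so off a single null set each point lies in at
  most one piece. Indexing by position also covers a region listed twice: it meets its copy in a
  null set.\<close>

lemma subdivision_AE_disjoint:
  assumes sub: "subdivision M S J Js" and S: "\<And>J. J \<in> S \<Longrightarrow> J \<in> sets M"
  shows "AE x in M. (\<Sum>J'\<in>#mset Js. indicator J' x) \<le> (indicator J x :: ennreal)"
proof -
  have meas: "Js ! i \<in> sets M" if "i < length Js" for i
    using sub that by (intro S) (auto simp: subdivision_def)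
  have "AE x in M. x \<notin> Js ! i \<inter> Js ! j" if "i < length Js" "j < length Js" "i \<noteq> j" for i j
    using sub that meas by (intro AE_not_in null_setsI) (auto simp: subdivision_def)
  then have "AE x in M. \<forall>i\<in>{..<length Js}. \<forall>j\<in>{..<length Js} - {i}. x \<notin> Js ! i \<inter> Js ! j"
    by (intro AE_finite_allI) auto
  then show ?thesis
  proof (rule AE_mp, intro AE_I2 impI)
    fix x
    assume disj: "\<forall>i\<in>{..<length Js}. \<forall>j\<in>{..<length Js} - {i}. x \<notin> Js ! i \<inter> Js ! j"
    have eq: "(\<Sum>J'\<in>#mset Js. indicator J' x) = (\<Sum>i<length Js. indicator (Js ! i) x :: ennreal)"
      by (simp add: sum_mset_sum_list sum_list_sum_nth atLeast0LessThan flip: mset_map)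
    show "(\<Sum>J'\<in>#mset Js. indicator J' x) \<le> (indicator J x :: ennreal)"
    proof (cases "\<exists>i<length Js. x \<in> Js ! i")
      case True
      then obtain i where i: "i < length Js" "x \<in> Js ! i" by blast
      have "(\<Sum>k<length Js. indicator (Js ! k) x :: ennreal)
          = indicator (Js ! i) x + (\<Sum>k\<in>{..<length Js} - {i}. indicator (Js ! k) x)"
        using i by (intro sum.remove) auto
      also have "(\<Sum>k\<in>{..<length Js} - {i}. indicator (Js ! k) x :: ennreal) = 0"
        using disj i by (intro sum.neutral) (auto simp: indicator_def)
      finally have "(\<Sum>k<length Js. indicator (Js ! k) x :: ennreal) = 1" using i by simp
      moreover have "x \<in> J" using sub i by (auto simp: subdivision_def)
      ultimately show ?thesis using eq by simp
    next
      case False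
      then show ?thesis unfolding eq by (simp add: indicator_def)
    qed
  qed
qed

lemma subdivision_run_regions:
  assumes "subdivision_run M S C l I T P" "I \<in> S"
  shows "set_mset P \<subseteq> S"
  using assms
proof induction
  case start
  then show ?case by simp
next
  case (subdivide T P J Js)
  then show ?case
    by (auto simp: subdivision_def simp del: diff_union_swap2 subset_mset.add_diff_assoc2 dest: in_diffD)
qed

text \<open>Overlaps are counted with multiplicity, and by the previous estimate replacing a region
  by its pieces does not increase the count almost everywhere.\<close>

lemma subdivision_run_AE_disjoint:
  assumes "subdivision_run M S C l I T P" and S: "\<And>J. J \<in> S \<Longrightarrow> J \<in> sets M"
  shows "AE x in M. (\<Sum>J\<in>#P. indicator J x) \<le> (indicator I x :: ennreal)"
  using assms(1)
proof induction
  case start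
  then show ?case by simp
next
  case (subdivide T P J Js)
  have "AE x in M. (\<Sum>J'\<in>#mset Js. indicator J' x) \<le> (indicator J x :: ennreal)"
    using subdivision_AE_disjoint[OF subdivide.hyps(4)] S by blast
  with subdivide.IH show ?case
  proof eventually_elim
    case (elim x)
    have "(\<Sum>J\<in>#P - {#J#} + mset Js. indicator J x)
        = (\<Sum>J\<in>#P - {#J#}. indicator J x) + (\<Sum>J\<in>#mset Js. indicator J x :: ennreal)"
      by simp
    also have "\<dots> \<le> (\<Sum>J\<in>#P - {#J#}. indicator J x) + indicator J x"
      using elim(2) by (rule add_left_mono)
    also have "\<dots> = (\<Sum>J\<in>#P. indicator J x)"
      using multi_member_split[OF subdivide.hyps(2)] by (auto simp: add.commute)
    also note elim(1)
    finally show ?case .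
  qed
qed

text \<open>The invariant keeps for each region its parent \<open>A\<close>, which failed all tests
  when it was subdivided; \<open>n\<close> is the depth of \<open>A\<close>. The initial region has
  no parent, whence the separate alternative. The diameter and measure bounds multiply from level to
  level.\<close>

lemma subdivision_run_depth:
  fixes \<epsilon>\<^sub>1 \<epsilon>\<^sub>2 :: real
  assumes "subdivision_run M S C l I T P" and "I \<in> S" and eps: "0 < \<epsilon>\<^sub>1" "0 < \<epsilon>\<^sub>2"
    and "\<And>J Js J'. (J, Js) \<in> set T \<Longrightarrow> J' \<in> set Js \<Longrightarrow>
           ennreal \<epsilon>\<^sub>1 * emeasure M J \<le> emeasure M J' \<and> diameter J' \<le> \<epsilon>\<^sub>2 * diameter J"
  shows "P = {#I#} \<or>
    (\<forall>J\<in>#P. \<exists>n. \<exists>A\<in>S. J \<subseteq> A \<and> (\<forall>i\<in>{1..l}. \<not> C i A) \<and>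
       diameter A \<le> \<epsilon>\<^sub>2 ^ n * diameter I \<and> diameter J \<le> \<epsilon>\<^sub>2 ^ Suc n * diameter I \<and>
       ennreal (\<epsilon>\<^sub>1 ^ Suc n) * emeasure M I \<le> emeasure M J)"
  using assms(1,5)
proof induction
  case start
  then show ?case by simp
next
  case (subdivide T P J Js)
  let ?Q = "\<lambda>J n A. A \<in> S \<and> J \<subseteq> A \<and> (\<forall>i\<in>{1..l}. \<not> C i A) \<and>
       diameter A \<le> \<epsilon>\<^sub>2 ^ n * diameter I \<and> diameter J \<le> \<epsilon>\<^sub>2 ^ Suc n * diameter I \<and>
       ennreal (\<epsilon>\<^sub>1 ^ Suc n) * emeasure M I \<le> emeasure M J"
  have IH: "P = {#I#} \<or> (\<forall>J\<in>#P. \<exists>n A. ?Q J n A)"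
    using subdivide.IH subdivide.prems by (simp add: Bex_def) meson
  have JS: "J \<in> S"
    using subdivision_run_regions[OF subdivide.hyps(1) \<open>I \<in> S\<close>] subdivide.hyps(2) by auto
  \<comment> \<open>\<open>m\<close> is the depth of \<open>J\<close>: 0 for the initial region,
    otherwise one more than the depth of its parent.\<close>
  obtain m where m: "diameter J \<le> \<epsilon>\<^sub>2 ^ m * diameter I"
    "ennreal (\<epsilon>\<^sub>1 ^ m) * emeasure M I \<le> emeasure M J"
  proof (cases "P = {#I#}")
    case True
    then have "J = I" using subdivide.hyps(2) by simp
    then show ?thesis by (intro that[of 0]) auto
  next
    case False
    then obtain n A where "?Q J n A" using IH subdivide.hyps(2) by blast
    then show ?thesis by (intro that[of "Suc n"]) auto
  qed
  have "\<exists>n A. ?Q J' n A" if "J' \<in># P - {#J#} + mset Js" for J'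
  proof (cases "J' \<in># P - {#J#}")
    case True
    \<comment> \<open>A region besides \<open>J\<close> survives, so \<open>P\<close> has at least
      two elements.\<close>
    then have "P \<noteq> {#I#}" using subdivide.hyps(2) by auto
    then show ?thesis using IH True by (meson in_diffD)
  next
    case False
    then have J': "J' \<in> set Js" using that by auto
    then have *: "ennreal \<epsilon>\<^sub>1 * emeasure M J \<le> emeasure M J'" "diameter J' \<le> \<epsilon>\<^sub>2 * diameter J"
      using subdivide.prems[of J Js J'] by auto
    have "\<epsilon>\<^sub>2 * diameter J \<le> \<epsilon>\<^sub>2 * (\<epsilon>\<^sub>2 ^ m * diameter I)"
      using m(1) eps by simp
    then have "diameter J' \<le> \<epsilon>\<^sub>2 ^ Suc m * diameter I"
      using *(2) by (simp add: mult.assoc)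
    moreover have "ennreal (\<epsilon>\<^sub>1 ^ Suc m) * emeasure M I = ennreal \<epsilon>\<^sub>1 * (ennreal (\<epsilon>\<^sub>1 ^ m) * emeasure M I)"
      using eps by (simp add: ennreal_mult mult.assoc)
    then have "ennreal (\<epsilon>\<^sub>1 ^ Suc m) * emeasure M I \<le> emeasure M J'"
      using m(2) *(1) by (metis mult_left_mono order_trans zero_le)
    moreover have "J' \<subseteq> J" using subdivide.hyps(4) J' by (auto simp: subdivision_def)
    \<comment> \<open>The region just subdivided failed all tests and serves as the parent of its
      pieces.\<close>
    ultimately have "?Q J' m J" using JS m(1) subdivide.hyps(3) by blast
    then show ?thesis by blast
  qed
  then show ?case by (simp add: Bex_def)
qed

lemma size_le_nn_integral:
  assumes "\<And>J. J \<in># P \<Longrightarrow> J \<in> sets M \<and> a \<le> c J * emeasure M J"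
  shows "of_nat (size P) * a \<le> (\<integral>\<^sup>+x. (\<Sum>J\<in>#P. c J * indicator J x) \<partial>M)"
proof -
  \<comment> \<open>Measurability is carried through the induction because additivity of the
    integral depends on it.\<close>
  have "of_nat (size P) * a \<le> (\<integral>\<^sup>+x. (\<Sum>J\<in>#P. c J * indicator J x) \<partial>M) \<and>
      (\<lambda>x. \<Sum>J\<in>#P. c J * indicator J x) \<in> borel_measurable M"
    using assms
  proof (induction P)
    case empty
    then show ?case by simp
  next
    case (add J P)
    have J: "J \<in> sets M" "a \<le> c J * emeasure M J" using add.prems by auto
    have IH: "of_nat (size P) * a \<le> (\<integral>\<^sup>+x. (\<Sum>J\<in>#P. c J * indicator J x) \<partial>M)"
      "(\<lambda>x. \<Sum>J\<in>#P. c J * indicator J x) \<in> borel_measurable M"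
      using add by auto
    then have "(\<integral>\<^sup>+x. (\<Sum>J\<in>#add_mset J P. c J * indicator J x) \<partial>M)
        = c J * emeasure M J + (\<integral>\<^sup>+x. (\<Sum>J\<in>#P. c J * indicator J x) \<partial>M)"
      using J by (simp add: nn_integral_add nn_integral_cmult_indicator)
    then show ?case
      using add_mono[OF J(2) IH(1)] IH(2) J(1) by (simp add: distrib_right)
  qed
  then show ?thesis by simp
qed


theorem proposition7:
  fixes M :: "'a::metric_space measure"
    and S :: "'a set set"
    and C :: "nat \<Rightarrow> 'a set \<Rightarrow> bool"
    and K :: "nat \<Rightarrow> real"
    and V :: "nat \<Rightarrow> 'a set"
    and l :: nat
    and \<epsilon>\<^sub>1 \<epsilon>\<^sub>2 :: real
    and I :: "'a set"
    and T :: "('a set \<times> 'a set list) list"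
    and P :: "'a set multiset"
  assumes "space M = UNIV"
    and proper: "\<And>(x::'a) r. compact (cball x r)"
    and regions: "\<And>J. J \<in> S \<Longrightarrow> J \<in> sets M \<and> emeasure M J < \<infinity> \<and> compact J"
    and "0 < \<epsilon>\<^sub>1" "\<epsilon>\<^sub>1 < 1" "0 < \<epsilon>\<^sub>2" "\<epsilon>\<^sub>2 < 1"
    and tests: "\<And>i. i \<in> {1..l} \<Longrightarrow> diameter_distance_test S (C i) (K i) (V i)"
    and "(\<Inter>i\<in>{1..l}. V i) = {}"
    and "I \<in> S" "0 < emeasure M I"
    and run: "subdivision_run M S C l I T P"
    and shrink: "\<And>J Js J'. (J, Js) \<in> set T \<Longrightarrow> J' \<in> set Js \<Longrightarrow>
           ennreal \<epsilon>\<^sub>1 * emeasure M J \<le> emeasure M J' \<and> diameter J' \<le> \<epsilon>\<^sub>2 * diameter J"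
    and final: "final_partition C l P"
  shows "of_nat (size P) \<le>
     max 1 (inverse (emeasure M I) *
       (\<integral>\<^sup>+x\<in>I. (MIN i\<in>{1..l}. bound_term \<epsilon>\<^sub>1 \<epsilon>\<^sub>2 (diameter I) (K i) (V i) x) \<partial>M))"
proof (cases "P = {#I#}")
  \<comment> \<open>Without a subdivision no failed test bounds the integrand from below; the 1 in
    the maximum covers this case.\<close>
  case True
  then show ?thesis by simp
next
  case False
  let ?f = "\<lambda>x. MIN i\<in>{1..l}. bound_term \<epsilon>\<^sub>1 \<epsilon>\<^sub>2 (diameter I) (K i) (V i) x"
  \<comment> \<open>The largest constant below the integrand on \<open>J\<close>, possibly infinite;
    it is the weight of \<open>J\<close> in the measurable minorant.\<close>
  define c where "c J = (INF x\<in>J. ?f x)" for J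
  \<comment> \<open>An intersection over no index is the whole space, so the empty intersection
    forces a criterion to exist and \<open>MIN\<close> to range over a nonempty set.\<close>
  have l: "{1..l} \<noteq> {}" using assms(9) by (metis INT_empty UNIV_not_empty)
  have muI: "emeasure M I \<noteq> 0" "emeasure M I \<noteq> \<infinity>"
    using assms(11) regions[OF \<open>I \<in> S\<close>] by auto
  have PS: "J \<in> S" if "J \<in># P" for J
    using subdivision_run_regions[OF run \<open>I \<in> S\<close>] that by auto
  have depth: "\<forall>J\<in>#P. \<exists>n. \<exists>A\<in>S. J \<subseteq> A \<and> (\<forall>i\<in>{1..l}. \<not> C i A) \<and>
       diameter A \<le> \<epsilon>\<^sub>2 ^ n * diameter I \<and> diameter J \<le> \<epsilon>\<^sub>2 ^ Suc n * diameter I \<and>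
       ennreal (\<epsilon>\<^sub>1 ^ Suc n) * emeasure M I \<le> emeasure M J"
    using subdivision_run_depth[OF run \<open>I \<in> S\<close> assms(4,6)] shrink False by blast
  have "emeasure M I \<le> c J * emeasure M J" if J: "J \<in># P" for J
  proof -
    obtain n A where A: "A \<in> S" "J \<subseteq> A" "\<forall>i\<in>{1..l}. \<not> C i A"
        "diameter A \<le> \<epsilon>\<^sub>2 ^ n * diameter I"
      and mu: "ennreal (\<epsilon>\<^sub>1 ^ Suc n) * emeasure M I \<le> emeasure M J"
      using depth J by blast
    have "bounded A" using regions[OF A(1)] compact_imp_bounded by blast
    \<comment> \<open>The terminal region \<open>J\<close> passes a test itself; the failed tests
      are those of \<open>A\<close>, evaluated at points of \<open>J\<close>, which lie in
      \<open>A\<close>.\<close>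
    then have "ennreal (1 / \<epsilon>\<^sub>1 ^ Suc n) \<le> bound_term \<epsilon>\<^sub>1 \<epsilon>\<^sub>2 (diameter I) (K i) (V i) x"
      if "i \<in> {1..l}" "x \<in> J" for i x
      using bound_term_ge[OF tests[OF that(1)] A(1) _ _ _ A(4)] A(2,3) that assms(4-7) by auto
    then have c: "ennreal (1 / \<epsilon>\<^sub>1 ^ Suc n) \<le> c J"
      unfolding c_def using l by (intro INF_greatest Min.boundedI) auto
    have "emeasure M I = ennreal (1 / \<epsilon>\<^sub>1 ^ Suc n) * (ennreal (\<epsilon>\<^sub>1 ^ Suc n) * emeasure M I)"
      using \<open>0 < \<epsilon>\<^sub>1\<close> by (simp add: mult.assoc[symmetric] flip: ennreal_mult')
    also have "\<dots> \<le> c J * emeasure M J"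
      using c mu by (intro mult_mono) auto
    finally show ?thesis .
  qed
  then have "of_nat (size P) * emeasure M I \<le> (\<integral>\<^sup>+x. (\<Sum>J\<in>#P. c J * indicator J x) \<partial>M)"
    using PS regions by (intro size_le_nn_integral) auto
  also have "\<dots> \<le> (\<integral>\<^sup>+x\<in>I. ?f x \<partial>M)"
  proof (rule nn_integral_mono_AE)
    have "AE x in M. (\<Sum>J\<in>#P. indicator J x) \<le> (indicator I x :: ennreal)"
      using subdivision_run_AE_disjoint[OF run] regions by blast
    then show "AE x in M. (\<Sum>J\<in>#P. c J * indicator J x) \<le> ?f x * indicator I x"
    proof eventually_elim
      case (elim x)
      \<comment> \<open>Replacing each \<open>c J\<close> by the value of the integrand at
        \<open>x\<close> gives a common factor, and the remaining count of regions containing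
        \<open>x\<close> is at most the indicator of \<open>I\<close>.\<close>
      have "(\<Sum>J\<in>#P. c J * indicator J x) \<le> (\<Sum>J\<in>#P. ?f x * indicator J x)"
        unfolding c_def by (intro sum_mset_mono) (auto intro: INF_lower simp: indicator_def)
      also have "\<dots> = ?f x * (\<Sum>J\<in>#P. indicator J x)"
        by (rule sum_mset_distrib_left[symmetric])
      also have "\<dots> \<le> ?f x * indicator I x"
        using elim by (intro mult_left_mono) auto
      finally show ?case .
    qed
  qed
  finally have "inverse (emeasure M I) * (of_nat (size P) * emeasure M I)
      \<le> inverse (emeasure M I) * (\<integral>\<^sup>+x\<in>I. ?f x \<partial>M)"
    by (rule mult_left_mono) simp
  \<comment> \<open>The cancellation is valid in \<open>ennreal\<close> because the measure of
    \<open>I\<close> is neither 0 nor infinite.\<close>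
  moreover have "inverse (emeasure M I) * (of_nat (size P) * emeasure M I) = of_nat (size P)"
    using muI
    by (metis ennreal_divide_times ennreal_divide_self divide_ennreal_def
        infinity_ennreal_def mult.assoc mult.commute mult.right_neutral top.not_eq_extremum)
  ultimately show ?thesis by (simp add: max.coboundedI2)
qed

end
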